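(* Let $T$ be any triangulation of the projective plane, and let $n_0^T, n_1^T, n_2^T$ be respectively the numbers of vertices, edges and triangles of $T$. Then $$n_0^T - n_1^T + n_2^T = 1.$$
   Context: The projective plane is represented as the sphere $\mathbb{S}^2 \subset \mathbb{R}^3$ with diametrically opposite points identified. A triangulation of the projective plane is given by a (finite) triangulation of the sphere that is symmetric with respect to the center of the sphere; simplices of the sphere that are diametrically opposite are identified and count as a single simplex of the triangulation of the projective plane. *)

theory Defs
  imports "HOL-Analysis.Analysis"
begin

text \<open>
  A triangulation of the sphere is a finite geometric simplicial complex \<open>K\<close> in some Euclidean
  space together with a homeomorphism \<open>h\<close> from its underlying space onto the unit sphere; the
  simplices of the sphere are the (curved) images \<open>h ` \<sigma>\<close>. The library's
  \<^const>\<open>simplicial_complex\<close> includes finiteness.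
\<close>

definition sphere_triangulation :: "'a::euclidean_space set set \<Rightarrow> ('a \<Rightarrow> real^3) \<Rightarrow> bool" where
  "sphere_triangulation K h \<longleftrightarrow>
     simplicial_complex K \<and> (\<exists>g. homeomorphism (\<Union>K) (sphere 0 1) h g)"

definition sphere_simplices ::
    "'a::euclidean_space set set \<Rightarrow> ('a \<Rightarrow> real^3) \<Rightarrow> int \<Rightarrow> (real^3) set set" where
  "sphere_simplices K h i = {h ` \<sigma> |\<sigma>. \<sigma> \<in> K \<and> i simplex \<sigma>}"

definition centrally_symmetric :: "'a::euclidean_space set set \<Rightarrow> ('a \<Rightarrow> real^3) \<Rightarrow> bool" where
  "centrally_symmetric K h \<longleftrightarrow> (\<forall>\<sigma>\<in>K. \<exists>\<tau>\<in>K. h ` \<tau> = uminus ` h ` \<sigma>)"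

definition projective_plane_triangulation ::
    "'a::euclidean_space set set \<Rightarrow> ('a \<Rightarrow> real^3) \<Rightarrow> bool" where
  "projective_plane_triangulation K h \<longleftrightarrow> sphere_triangulation K h \<and> centrally_symmetric K h"

definition antipodal_rel :: "(real^3) set rel" where
  "antipodal_rel = {(S, S'). S' = S \<or> S' = uminus ` S}"

lemma equiv_antipodal_rel: "equiv UNIV antipodal_rel"
  by (rule equivI) (auto simp: antipodal_rel_def refl_on_def sym_def trans_def image_image)

definition projective_simplices ::
    "'a::euclidean_space set set \<Rightarrow> ('a \<Rightarrow> real^3) \<Rightarrow> int \<Rightarrow> (real^3) set set set" where
  "projective_simplices K h i = sphere_simplices K h i // antipodal_rel"

end

theory Submission
  imports Defs
begin

text \<open>
  Euler's formula for a connected plane graph follows by adding edges one at a time: an edge with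
  one new end vertex leaves the number of faces unchanged (Janiszewski), and an edge joining two old
  vertices splits exactly one face in two (Jordan and Janiszewski). By invariance of dimension the
  maximal simplices of a triangulated sphere are triangles, so puncturing the sphere inside a
  triangle turns the 1-skeleton into a connected plane graph whose faces are the open triangles, and
  the Euler characteristic is 2. The antipodal map permutes the simplices preserving dimension, and
  without fixed simplices by Brouwer's theorem; hence it halves every count.
\<close>

subsection \<open>Euler's formula for plane graphs\<close>

text \<open>The dimension of \<open>K\<close> is not prescribed either: its ambient space is
  arbitrary, so purity must come from topology.

  In the count, Jordan's theorem bounds the number of pieces from below. Janiszewski's theorem
  bounds it from above: if a compact and a closed set have connected intersection, two points that
  neither of them separates are not separated by their union.

  For the antipodal map the passage goes the other way, from curved to flat. Pulled back along
  \<open>h\<close>, it acts on convex simplices, where Brouwer's theorem and affine dimension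
  apply.\<close>

text \<open>The other members have an open union, so each member is clopen in the whole, and no
  connected subset of the union can properly contain it. Every face count below exhibits such a
  partition and reads off the components.\<close>

lemma components_Union_open:
  fixes \<C> :: "'a::topological_space set set"
  assumes \<C>: "\<And>C. C \<in> \<C> \<Longrightarrow> open C \<and> connected C \<and> C \<noteq> {}"
    and disj: "pairwise disjnt \<C>"
  shows "components (\<Union>\<C>) = \<C>"
proof -
  have sub: "C \<in> components (\<Union>\<C>)" if "C \<in> \<C>" for C
    unfolding in_components_maximal
  proof (intro conjI allI impI)
    fix D assume D: "D \<noteq> {} \<and> C \<subseteq> D \<and> D \<subseteq> \<Union>\<C> \<and> connected D"
    have op: "open C" "open (\<Union>(\<C> - {C}))"
      using \<C> that by auto
    have "C \<inter> \<Union>(\<C> - {C}) = {}"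
      using disj that by (force simp: pairwise_def disjnt_def)
    moreover have "C \<inter> D \<noteq> {}"
      using D \<C> that by blast
    moreover have "D \<subseteq> C \<union> \<Union>(\<C> - {C})"
      using D by blast
    ultimately have "\<Union>(\<C> - {C}) \<inter> D = {}"
      using connectedD [of D C "\<Union>(\<C> - {C})"] op D by blast
    then show "D = C"
      using D by blast
  qed (use \<C> that in auto)
  moreover have "D \<in> \<C>" if D: "D \<in> components (\<Union>\<C>)" for D
  proof -
    obtain x where "x \<in> D"
      using in_components_nonempty [OF D] by blast
    then obtain C where "x \<in> C" "C \<in> \<C>"
      using in_components_subset [OF D] by blast
    then show ?thesis
      using components_eq [OF D sub] \<open>x \<in> D\<close> by blast
  qed
  ultimately show ?thesis
    by blast
qed

text \<open>An arc is a copy of an interval, so an open set inside it would embed in the line,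
  against invariance of dimension. It ensures that an edge never swallows a whole face.\<close>

lemma open_not_subset_arc_image:
  fixes g :: "real \<Rightarrow> 'a::euclidean_space"
  assumes "arc g" "open U" "U \<noteq> {}" "2 \<le> DIM('a)"
  shows "\<not> U \<subseteq> path_image g"
proof
  assume U: "U \<subseteq> path_image g"
  obtain k where k: "homeomorphism {0..1} (path_image g) g k"
    using homeomorphism_arc [OF \<open>arc g\<close>] .
  then have "inj_on k U" "continuous_on U k"
    using U homeomorphism_symD[OF k]
    by (auto simp: homeomorphism_def inj_on_def subset_iff intro: continuous_on_subset) metis
  then have "DIM('a) \<le> DIM(real)"
    using invariance_of_dimension assms by blast
  then show False
    using assms by simp
qed

lemma open_component_Compl:
  fixes S :: "'a::real_normed_vector set"
  assumes "compact S" "U \<in> components (- S)"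
  shows "open U"
  using assms open_components [of "- S" U] by (simp add: compact_imp_closed open_Compl)

text \<open>An arc alone does not separate the plane. As it meets \<open>S\<close> in a connected
  set, Janiszewski's theorem shows that it separates no two points of a component of
  \<open>- S\<close> outside it. This is the case of an edge with a new end vertex, where the
  intersection is one point.\<close>

lemma bij_betw_components_Compl_Un_arc:
  fixes S :: "complex set"
  assumes "compact S" "arc g" "connected (S \<inter> path_image g)"
  shows "bij_betw (\<lambda>U. U - path_image g) (components (- S)) (components (- (S \<union> path_image g)))"
proof -
  let ?e = "path_image g" and ?f = "\<lambda>U. U - path_image g"
  have comp: "open U" "U \<noteq> {}" "connected U" "U \<subseteq> - S" if "U \<in> components (- S)" for U
    using that open_component_Compl [OF \<open>compact S\<close>] in_components_connected
      in_components_nonempty in_components_subset by blast+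
  have disj: "U \<inter> U' = {}" if "U \<in> components (- S)" "U' \<in> components (- S)" "U \<noteq> U'" for U U'
    using that components_nonoverlap by blast
  have ne: "?f U \<noteq> {}" if "U \<in> components (- S)" for U
    using open_not_subset_arc_image [OF \<open>arc g\<close>, of U] comp [OF that] by auto
  have con: "connected (?f U)" if U: "U \<in> components (- S)" for U
    unfolding connected_iff_connected_component
  proof (intro ballI)
    fix x y assume xy: "x \<in> ?f U" "y \<in> ?f U"
    have "connected_component (- S) x y"
      using xy comp [OF U] unfolding connected_component_def by blast
    moreover have "connected_component (- ?e) x y"
      using connected_arc_complement [OF \<open>arc g\<close>] xy
      unfolding connected_iff_connected_component by auto
    ultimately have "connected_component (- (S \<union> ?e)) x y"
      using Janiszewski assms closed_arc_image by blast
    then obtain C where C: "connected C" "C \<subseteq> - (S \<union> ?e)" "x \<in> C" "y \<in> C"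
      unfolding connected_component_def by blast
    then have "C \<subseteq> U"
      using components_maximal [OF U, of C] xy by blast
    then show "connected_component (?f U) x y"
      unfolding connected_component_def using C by blast
  qed
  have "components (\<Union>(?f ` components (- S))) = ?f ` components (- S)"
  proof (rule components_Union_open)
    show "open C \<and> connected C \<and> C \<noteq> {}" if "C \<in> ?f ` components (- S)" for C
      using that con ne comp(1) closed_arc_image [OF \<open>arc g\<close>] by auto
    show "pairwise disjnt (?f ` components (- S))"
      using disj unfolding pairwise_def disjnt_def by blast
  qed
  moreover have "\<Union>(?f ` components (- S)) = - (S \<union> ?e)"
    using Union_components [of "- S"] by blast
  moreover have "inj_on ?f (components (- S))"
  proof (rule inj_onI, rule ccontr)
    fix U U' assume U: "U \<in> components (- S)" "U' \<in> components (- S)" "?f U = ?f U'" "U \<noteq> U'"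
    then have "?f U \<subseteq> U \<inter> U'"
      by blast
    then show False
      using disj [OF U(1,2,4)] ne [OF U(1)] by simp
  qed
  ultimately show ?thesis
    by (simp add: bij_betw_def)
qed

text \<open>Closing up \<open>g\<close> to a Jordan curve inside \<open>S\<close>, Jordan's theorem splits the component that
  contains \<open>g\<close> into at least two parts, and Janiszewski's theorem shows that each part is connected.\<close>

lemma card_components_Compl_Un_arc:
  fixes S :: "complex set"
  assumes "compact S" "path_connected S" "arc g"
    and ends: "S \<inter> path_image g = {pathstart g, pathfinish g}"
    and fin: "finite (components (- S))"
  shows "finite (components (- (S \<union> path_image g)))"
    and "card (components (- (S \<union> path_image g))) = Suc (card (components (- S)))"
proof -
  let ?e = "path_image g"
  have "pathstart g \<noteq> pathfinish g"
    using \<open>arc g\<close> arc_distinct_ends by metis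
  moreover have "pathstart g \<in> S" "pathfinish g \<in> S"
    using ends by auto
  ultimately obtain p where p: "arc p" "path_image p \<subseteq> S" "pathstart p = pathfinish g"
      "pathfinish p = pathstart g"
    using \<open>path_connected S\<close> unfolding path_connected_arcwise by metis
  define J where "J = path_image (g +++ p)"
  have Jeq: "J = ?e \<union> path_image p"
    using p by (simp add: J_def path_image_join)
  have "simple_path (g +++ p)" "pathfinish (g +++ p) = pathstart (g +++ p)"
    using p ends by (auto intro!: simple_path_join_loop \<open>arc g\<close>)
  note Jordan = Jordan_inside_outside [OF this, folded J_def]
  \<comment> \<open>Janiszewski's theorem does not apply to \<open>S\<close> and the arc itself,
    which meet in two points. Passing to \<open>J\<close> makes the intersection the connected arc
    \<open>p\<close> and leaves the union with \<open>S\<close> unchanged.\<close>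
  have SJ: "S \<inter> J = path_image p" "S \<union> J = S \<union> ?e"
  proof -
    have "S \<inter> ?e \<subseteq> path_image p"
      unfolding ends using p(3,4) pathstart_in_path_image [of p] pathfinish_in_path_image [of p]
      by simp
    then show "S \<inter> J = path_image p" "S \<union> J = S \<union> ?e"
      using p(2) unfolding Jeq by fast+
  qed
  have "compact J"
    using \<open>arc g\<close> p by (simp add: Jeq compact_Un compact_arc_image)
  let ?inner = "?e - {pathstart g, pathfinish g}"
  have "connected ?inner" "?inner \<noteq> {}"
    using arc_imp_simple_path [OF \<open>arc g\<close>] connected_simple_path_endless
      nonempty_simple_path_endless by blast+
  moreover have innerS: "?inner \<subseteq> - S"
    using ends by blast
  \<comment> \<open>The arc without its ends is connected and misses \<open>S\<close>, so it lies in
    a single component \<open>U\<close>. The other components avoid the whole arc and survive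
    unchanged.\<close>
  ultimately obtain U where U: "U \<in> components (- S)" "?inner \<subseteq> U"
    using exists_component_superset [of ?inner "- S"] by blast
  have "open U" "U \<subseteq> - S" "connected U"
    using U open_component_Compl [OF \<open>compact S\<close>] in_components_connected
      in_components_subset by blast+
  obtain z where z: "z \<in> ?inner"
    using \<open>?inner \<noteq> {}\<close> by blast
  have disjJ: "inside J \<inter> outside J = {}" and unJ: "inside J \<union> outside J = - J"
    using Jordan by simp_all
  define A where "A = (\<lambda>D. U \<inter> D) ` {inside J, outside J}"
  have side: "open (U \<inter> D) \<and> connected (U \<inter> D) \<and> U \<inter> D \<noteq> {}"
    if D: "D \<in> {inside J, outside J}" for D
  proof (intro conjI)
    have fr: "frontier D = J" "open D" "connected D"
      using D Jordan by auto
    have DJ: "D \<subseteq> - J"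
      using D unJ by blast
    show "open (U \<inter> D)"
      using \<open>open U\<close> fr by auto
    \<comment> \<open>Each side has all of \<open>J\<close> as its frontier, so it accumulates at
      the inner arc point \<open>z\<close>; since \<open>U\<close> is a neighbourhood of
      \<open>z\<close>, it meets both sides.\<close>
    have "z \<in> closure D"
      using fr(1) z unfolding Jeq frontier_def by blast
    then show "U \<inter> D \<noteq> {}"
      using \<open>open U\<close> z U(2) open_Int_closure_eq_empty [of U D] by blast
    show "connected (U \<inter> D)"
      unfolding connected_iff_connected_component
    proof (intro ballI)
      fix x y assume xy: "x \<in> U \<inter> D" "y \<in> U \<inter> D"
      have "connected_component (- S) x y"
        using xy \<open>connected U\<close> \<open>U \<subseteq> - S\<close> unfolding connected_component_def by blast
      moreover have "connected_component (- J) x y"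
        using xy fr(3) DJ unfolding connected_component_def by blast
      moreover have "connected (S \<inter> J)"
        using SJ p connected_arc_image by metis
      ultimately have "connected_component (- (S \<union> J)) x y"
        using Janiszewski \<open>compact S\<close> \<open>compact J\<close> compact_imp_closed by blast
      then obtain C where C: "connected C" "C \<subseteq> - (S \<union> J)" "x \<in> C" "y \<in> C"
        unfolding connected_component_def by blast
      have "C \<subseteq> U"
        using components_maximal [OF U(1), of C] xy C by blast
      moreover have "C \<subseteq> D"
      proof -
        have "components (\<Union>{inside J, outside J}) = {inside J, outside J}"
        proof (rule components_Union_open)
          show "open C \<and> connected C \<and> C \<noteq> {}" if "C \<in> {inside J, outside J}" for C
            using that Jordan by fastforce
          show "pairwise disjnt {inside J, outside J}"
            using disjJ by (simp add: pairwise_insert disjnt_def Int_commute)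
        qed
        then have "D \<in> components (- J)"
          using D unJ by simp
        then show ?thesis
          using components_maximal [of D "- J" C] xy C by blast
      qed
      ultimately show "connected_component (U \<inter> D) x y"
        unfolding connected_component_def using C by blast
    qed
  qed
  have disjA: "(U \<inter> inside J) \<inter> (U \<inter> outside J) = {}"
    using disjJ by blast
  have UA: "\<Union>A = U - ?e"
  proof -
    have "\<Union>A = U \<inter> (inside J \<union> outside J)"
      unfolding A_def by blast
    also have "\<dots> = U - (?e \<union> path_image p)"
      unfolding unJ by (simp only: Jeq Diff_eq)
    also have "\<dots> = U - ?e"
      using \<open>U \<subseteq> - S\<close> p(2) by blast
    finally show ?thesis .
  qed
  have "U \<inter> inside J \<noteq> U \<inter> outside J"
    using disjA side [of "inside J"] by auto
  then have "card A = 2"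
    by (simp add: A_def)
  have "finite A"
    by (simp add: A_def)
  let ?R = "components (- S) - {U}"
  have Re: "C \<inter> ?e = {} \<and> C \<inter> U = {}" if "C \<in> ?R" for C
  proof -
    have "C \<inter> U = {}" "C \<inter> S = {}"
      using that U(1) components_nonoverlap [of C "- S" U] in_components_subset [of C "- S"] by auto
    moreover have "?e \<subseteq> U \<union> S"
      using U(2) ends by blast
    ultimately show ?thesis
      by blast
  qed
  have "components (\<Union>(?R \<union> A)) = ?R \<union> A"
  proof (rule components_Union_open)
    show "open C \<and> connected C \<and> C \<noteq> {}" if "C \<in> ?R \<union> A" for C
    proof (cases "C \<in> A")
      case True
      then show ?thesis
        using side by (auto simp: A_def)
    next
      case False
      then have "C \<in> components (- S)"
        using that by blast
      then show ?thesis
        using open_component_Compl [OF \<open>compact S\<close>] in_components_connected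
          in_components_nonempty by blast
    qed
    have "pairwise disjnt ?R"
      using pairwise_disjoint_components [of "- S"] by (auto simp: pairwise_def disjnt_def)
    moreover have "pairwise disjnt A"
      using disjA by (simp add: A_def pairwise_insert disjnt_def Int_commute)
    moreover have "disjnt C D" if "C \<in> ?R" "D \<in> A" for C D
      using Re [OF that(1)] that(2) by (auto simp: A_def disjnt_def)
    ultimately show "pairwise disjnt (?R \<union> A)"
      unfolding pairwise_def by (metis Un_iff disjnt_sym)
  qed
  moreover have "\<Union>(?R \<union> A) = - (S \<union> ?e)"
  proof -
    have "- S = U \<union> \<Union>?R"
      using Union_components [of "- S"] U(1) by blast
    moreover have "\<Union>?R \<inter> ?e = {}"
      using Re by blast
    moreover have "\<Union>(?R \<union> A) = \<Union>?R \<union> (U - ?e)"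
      by (simp only: Union_Un_distrib UA)
    ultimately show ?thesis
      by (simp only: compl_sup) blast
  qed
  ultimately have eq: "components (- (S \<union> ?e)) = ?R \<union> A"
    by simp
  then show "finite (components (- (S \<union> ?e)))"
    using fin \<open>finite A\<close> by simp
  have "?R \<inter> A = {}"
  proof -
    have "C \<inter> U \<noteq> {}" if "C \<in> A" for C
      using that side by (auto simp: A_def)
    then show ?thesis
      using Re by blast
  qed
  then have "card (components (- (S \<union> ?e))) = card ?R + 2"
    using eq fin \<open>finite A\<close> \<open>card A = 2\<close> by (simp add: card_Un_disjoint)
  then show "card (components (- (S \<union> ?e))) = Suc (card (components (- S)))"
    using card_Suc_Diff1 [OF fin U(1)] by simp
qed

section \<open>Connected plane graphs\<close>

text \<open>Edges are point sets that contain their ends. Loops are excluded because an arc is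
  injective; parallel edges are allowed.\<close>

definition plane_graph :: "complex set \<Rightarrow> complex set set \<Rightarrow> bool" where
  "plane_graph V E \<longleftrightarrow> finite V \<and> finite E \<and>
     (\<forall>e\<in>E. \<exists>g. arc g \<and> path_image g = e \<and> e \<inter> V = {pathstart g, pathfinish g}) \<and>
     pairwise (\<lambda>e e'. e \<inter> e' \<subseteq> V) E"

text \<open>Exhaust the graph by connected subgraphs, adding one edge (possibly with a new end vertex)
  at a time.\<close>

theorem plane_graph_Euler:
  assumes G: "plane_graph V E" and con: "connected (V \<union> \<Union>E)" and "V \<noteq> {}"
  shows "card V + card (components (- (V \<union> \<Union>E))) = card E + 2"
proof -
  have "finite V" "finite E"
    using G by (auto simp: plane_graph_def)
  have edge: "\<exists>g. arc g \<and> path_image g = e \<and> e \<inter> V = {pathstart g, pathfinish g}" if "e \<in> E" for e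
    using G that by (auto simp: plane_graph_def)
  have meet: "e \<inter> e' \<subseteq> V" if "e \<in> E" "e' \<in> E" "e \<noteq> e'" for e e'
    using G that by (auto simp: plane_graph_def pairwise_def)
  have compact_e: "compact e" if "e \<in> E" for e
    using edge [OF that] compact_arc_image by blast
  \<comment> \<open>The invariant of the exhaustion. Path-connectedness, rather than connectedness,
    provides the arc that closes a new edge up to a Jordan curve.\<close>
  define P where "P W F \<longleftrightarrow> W \<subseteq> V \<and> W \<noteq> {} \<and> F \<subseteq> E \<and> (\<forall>e\<in>F. e \<inter> V \<subseteq> W) \<and>
      path_connected (W \<union> \<Union>F) \<and> finite (components (- (W \<union> \<Union>F))) \<and>
      card W + card (components (- (W \<union> \<Union>F))) = card F + 2" for W F
  have compact_WF: "compact (W \<union> \<Union>F)" if "W \<subseteq> V" "F \<subseteq> E" for W F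
    using that \<open>finite V\<close> \<open>finite E\<close> compact_e
    by (intro compact_Un compact_Union) (auto intro: finite_subset finite_imp_compact)
  have sep: "V - W = {} \<and> E - F = {}"
    if "P W F" "\<And>e. e \<in> E - F \<Longrightarrow> e \<inter> W = {}" for W F
  proof -
    have sub: "W \<subseteq> V" "F \<subseteq> E" "W \<noteq> {}" "\<And>e. e \<in> F \<Longrightarrow> e \<inter> V \<subseteq> W"
      using that by (auto simp: P_def)
    let ?A = "W \<union> \<Union>F" and ?B = "(V - W) \<union> \<Union>(E - F)"
    have "closed ?A" "closed ?B"
      using sub by (auto intro!: compact_imp_closed compact_WF)
    moreover have "?A \<inter> ?B = {}"
    proof -
      have "e \<inter> e' = {}" if "e \<in> F" "e' \<in> E - F" for e e'
        using meet [of e e'] that sub(4) [of e] \<open>F \<subseteq> E\<close> \<open>P W F\<close> \<open>\<And>e. e \<in> E - F \<Longrightarrow> e \<inter> W = {}\<close> [of e']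
        by blast
      then show ?thesis
        using that(2) sub(4) by blast
    qed
    moreover have un: "V \<union> \<Union>E = ?A \<union> ?B"
      using sub by blast
    ultimately have "?A \<inter> (V \<union> \<Union>E) = {} \<or> ?B \<inter> (V \<union> \<Union>E) = {}"
      by (intro connected_closedD [OF con]) simp_all
    then have "?A = {} \<or> ?B = {}"
      unfolding un by (simp add: Int_Un_distrib)
    then have "V - W = {}" "\<Union>(E - F) = {}"
      using sub(3) by simp_all
    moreover have "{} \<notin> E"
      using edge by blast
    ultimately show ?thesis
      by (metis Diff_iff Sup_bot_conv(1) ex_in_conv)
  qed
  have step: "\<exists>W' F'. P W' F' \<and> F \<subset> F'" if WF: "P W F" and "F \<noteq> E" for W F
  proof -
    have sub: "W \<subseteq> V" "F \<subseteq> E" "W \<noteq> {}" "\<And>e. e \<in> F \<Longrightarrow> e \<inter> V \<subseteq> W"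
      and pc: "path_connected (W \<union> \<Union>F)" and fin: "finite (components (- (W \<union> \<Union>F)))"
      and cd: "card W + card (components (- (W \<union> \<Union>F))) = card F + 2"
      using WF by (auto simp: P_def)
    let ?S = "W \<union> \<Union>F"
    have finW: "finite W" "finite F"
      using sub \<open>finite V\<close> \<open>finite E\<close> by (auto intro: finite_subset)
    obtain e where e: "e \<in> E" "e \<notin> F" "e \<inter> W \<noteq> {}"
      using sep [OF WF] \<open>F \<noteq> E\<close> sub(2) by blast
    obtain g where g: "arc g" "path_image g = e" "e \<inter> V = {pathstart g, pathfinish g}"
      using edge [OF e(1)] by blast
    \<comment> \<open>Inner points of the new edge lie on no old edge, so it meets the subgraph only
      in those of its two ends that are already in \<open>W\<close>: one or both.\<close>
    have eS: "?S \<inter> e = e \<inter> W"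
      using meet [OF e(1)] sub e by blast
    have Un: "(W \<union> e \<inter> V) \<union> \<Union>(insert e F) = ?S \<union> path_image g"
      using g by auto
    have pc': "path_connected (?S \<union> path_image g)"
      using path_connected_Un [OF pc path_connected_path_image [OF arc_imp_path [OF g(1)]]] eS e(3) g(2) by blast
    have sub': "W \<union> e \<inter> V \<subseteq> V" "W \<union> e \<inter> V \<noteq> {}" "insert e F \<subseteq> E" 
      "\<forall>e'\<in>insert e F. e' \<inter> V \<subseteq> W \<union> e \<inter> V"
      using sub e by auto
    have ends: "e \<inter> W \<subseteq> {pathstart g, pathfinish g}" "pathstart g \<noteq> pathfinish g"
      using g sub arc_distinct_ends by (blast, metis)
    have "finite (components (- (?S \<union> path_image g))) \<and>
      card (W \<union> e \<inter> V) + card (components (- (?S \<union> path_image g))) = card (insert e F) + 2"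
    proof (cases "e \<inter> W = {pathstart g, pathfinish g}")
      case True
      then have "W \<union> e \<inter> V = W"
        using g by blast
      then show ?thesis
        using card_components_Compl_Un_arc [OF compact_WF pc g(1) _ fin] True eS g(2) sub cd e finW
        by simp
    next
      case False
      then obtain a b where ab: "e \<inter> W = {a}" "e \<inter> V = {a, b}" "b \<notin> W"
      proof (cases "pathstart g \<in> W")
        case True
        then show ?thesis
          using that [of "pathstart g" "pathfinish g"] False ends g(3) by blast
      next
        case False
        then show ?thesis
          using that [of "pathfinish g" "pathstart g"] ends g(3) e(3) by blast
      qed
      then have "W \<union> e \<inter> V = insert b W"
        by blast
      then have "card (W \<union> e \<inter> V) = Suc (card W)"
        using finW \<open>b \<notin> W\<close> by simp
      moreover have bij: "bij_betw (\<lambda>U. U - path_image g) (components (- ?S))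
          (components (- (?S \<union> path_image g)))"
        using bij_betw_components_Compl_Un_arc [OF compact_WF g(1)] sub eS ab g(2) by simp
      ultimately show ?thesis
        using bij_betw_finite [OF bij] bij_betw_same_card [OF bij] fin cd e finW by simp
    qed
    then have "P (W \<union> e \<inter> V) (insert e F)"
      unfolding P_def Un using sub' pc' by blast
    then show ?thesis
      using e by blast
  qed
  \<comment> \<open>A single vertex does not separate the plane, and the formula reads 1 + 1 = 0 +
    2.\<close>
  have base: "\<exists>W. P W {}"
  proof -
    obtain v where "v \<in> V"
      using \<open>V \<noteq> {}\<close> by blast
    have "connected (- {v})" "- {v} \<noteq> {}"
      using connected_punctured_universe [of v] by (auto simp: set_eq_iff) (metis zero_neq_one)
    then have "components (- {v}) = {- {v}}"
      by (simp add: components_eq_sing_iff)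
    then have "P {v} {}"
      using \<open>v \<in> V\<close> by (simp add: P_def)
    then show ?thesis ..
  qed
  have "\<exists>W F. P W F \<and> card F \<ge> n" if "n \<le> card E" for n
    using that
  proof (induction n)
    case 0 then show ?case using base by blast
  next
    case (Suc n)
    then obtain W F where WF: "P W F" "card F \<ge> n"
      by auto
    show ?case
    proof (cases "F = E")
      case True
      then show ?thesis using WF Suc.prems by blast
    next
      case False
      then obtain W' F' where "P W' F'" "F \<subset> F'"
        using step WF by blast
      moreover have "finite F'"
        using \<open>P W' F'\<close> \<open>finite E\<close> by (auto simp: P_def intro: finite_subset)
      ultimately show ?thesis
        using WF psubset_card_mono [of F' F] by (metis Suc_leI le_less_trans)
    qed
  qed
  then obtain W F where WF: "P W F" "card F \<ge> card E"
    by blast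
  then have "F = E"
    using \<open>finite E\<close> by (simp add: P_def card_seteq)
  moreover have "W = V"
    using sep [OF WF(1)] \<open>F = E\<close> WF(1) by (auto simp: P_def)
  ultimately show ?thesis
    using WF by (simp add: P_def)
qed

subsection \<open>Triangulations of the sphere\<close>

text \<open>Two simplices meet in a common face, and the only face of \<open>\<sigma>\<close> that
  reaches its relative interior is \<open>\<sigma>\<close> itself.\<close>

lemma simplicial_complex_face_subset:
  assumes "simplicial_complex K" "\<sigma> \<in> K" "\<tau> \<in> K" "\<tau> \<inter> rel_interior \<sigma> \<noteq> {}"
  shows "\<sigma> \<subseteq> \<tau>" "\<sigma> face_of \<tau>"
proof -
  have "\<sigma> \<inter> \<tau> face_of \<sigma>" "\<tau> \<inter> \<sigma> face_of \<tau>"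
    using assms by (auto simp: simplicial_complex_def)
  moreover have "\<sigma> \<inter> \<tau> \<inter> rel_interior \<sigma> \<noteq> {}"
    using assms rel_interior_subset [of \<sigma>] by blast
  ultimately have "\<sigma> \<inter> \<tau> = \<sigma>"
    using face_of_disjoint_rel_interior by blast
  then show "\<sigma> \<subseteq> \<tau>" "\<sigma> face_of \<tau>"
    using \<open>\<tau> \<inter> \<sigma> face_of \<tau>\<close> by (auto simp: Int_commute)
qed

lemma simplicial_complex_simplex_iff:
  assumes "simplicial_complex K" "\<sigma> \<in> K"
  shows "i simplex \<sigma> \<longleftrightarrow> aff_dim \<sigma> = i"
  using assms aff_dim_simplex unfolding simplicial_complex_def by blast

lemma simplicial_complex_polytope:
  assumes "simplicial_complex K" "\<sigma> \<in> K"
  shows "convex \<sigma>" "compact \<sigma>" "closed \<sigma>" "polyhedron \<sigma>"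
  using assms convex_simplex compact_simplex closed_simplex simplex_imp_polyhedron
  unfolding simplicial_complex_def by blast+

lemma simplicial_complex_rel_interior_or_proper_face:
  assumes K: "simplicial_complex K" "\<sigma> \<in> K" and x: "x \<in> \<sigma>" "x \<notin> rel_interior \<sigma>"
  obtains \<tau> where "\<tau> \<in> K" "\<tau> face_of \<sigma>" "\<tau> \<noteq> \<sigma>" "x \<in> \<tau>"
proof -
  have "x \<in> rel_frontier \<sigma>"
    using x simplicial_complex_polytope [OF K] by (simp add: rel_frontier_def)
  then obtain \<tau> where "\<tau> face_of \<sigma>" "\<tau> \<noteq> \<sigma>" "x \<in> \<tau>"
    using rel_frontier_of_polyhedron_alt [OF simplicial_complex_polytope(4) [OF K]] by blast
  then show thesis
    using K that unfolding simplicial_complex_def by blast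
qed

text \<open>The relative interior is what remains after removing the finitely many other simplices,
  which are closed: maximality keeps them away from it, and the rest of \<open>\<sigma>\<close> is
  covered by its proper faces.\<close>

lemma openin_rel_interior_maximal_simplex:
  assumes K: "simplicial_complex K" "\<sigma> \<in> K" and max: "\<And>\<tau>. \<tau> \<in> K \<Longrightarrow> \<sigma> \<subseteq> \<tau> \<Longrightarrow> \<tau> = \<sigma>"
  shows "openin (top_of_set (\<Union>K)) (rel_interior \<sigma>)"
proof -
  have "\<Union>(K - {\<sigma>}) \<inter> rel_interior \<sigma> = {}"
    using simplicial_complex_face_subset(1) [OF K] max by blast
  moreover have "\<Union>K - rel_interior \<sigma> \<subseteq> \<Union>(K - {\<sigma>})"
    using simplicial_complex_rel_interior_or_proper_face [OF K] by blast
  ultimately have "rel_interior \<sigma> = \<Union>K \<inter> - \<Union>(K - {\<sigma>})"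
    using K(2) rel_interior_subset [of \<sigma>] by blast
  moreover have "closed (\<Union>(K - {\<sigma>}))"
    using K simplicial_complex_polytope(3) [OF K(1)]
    by (intro closed_Union) (auto simp: simplicial_complex_def)
  ultimately show ?thesis
    by (metis openin_open open_Compl)
qed

section \<open>Purity of a triangulated sphere\<close>

lemma punctured_sphere_homeomorphism_plane:
  fixes b :: "real^3"
  assumes "norm b = 1"
  obtains \<phi> \<psi> where "homeomorphism (sphere 0 1 - {b}) (UNIV::complex set) \<phi> \<psi>"
proof -
  have "(sphere 0 1 - {b}) homeomorphic (UNIV::complex set)"
    by (rule homeomorphic_punctured_sphere_affine) (use assms in auto)
  then show thesis
    using that unfolding homeomorphic_def by blast
qed

lemma sphere_triangulation_nonempty:
  assumes "sphere_triangulation K h"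
  obtains \<sigma> where "\<sigma> \<in> K" "\<sigma> \<noteq> {}"
proof -
  obtain g where "homeomorphism (\<Union>K) (sphere 0 1) h g"
    using assms unfolding sphere_triangulation_def by blast
  moreover have "sphere (0::real^3) 1 \<noteq> {}"
    by simp
  ultimately have "\<Union>K \<noteq> {}"
    using homeomorphism_image1 by (metis image_empty)
  then show thesis
    using that by blast
qed

lemma sphere_antipode_neq:
  fixes x :: "real^3"
  assumes "x \<in> sphere 0 1"
  shows "- x \<noteq> x"
proof
  assume "- x = x"
  then have "x = 0"
    by (simp only: vec_eq_iff vector_uminus_component zero_index) simp
  then show False
    using assms by simp
qed

text \<open>Near an interior point, a maximal simplex is open in the complex, hence homeomorphic to
  an open set of the plane. Invariance of dimension, applied to this map and to its inverse on a
  disc, gives the two inequalities.\<close>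

lemma aff_dim_maximal_simplex:
  fixes K :: "'a::euclidean_space set set" and h :: "'a \<Rightarrow> real^3"
  assumes KS: "sphere_triangulation K h" and "\<sigma> \<in> K"
    and max: "\<And>\<tau>. \<tau> \<in> K \<Longrightarrow> \<sigma> \<subseteq> \<tau> \<Longrightarrow> \<tau> = \<sigma>"
  shows "aff_dim \<sigma> = 2"
proof -
  obtain g where K: "simplicial_complex K" and g: "homeomorphism (\<Union>K) (sphere 0 1) h g"
    using KS unfolding sphere_triangulation_def by blast
  have "\<sigma> \<noteq> {}"
    using sphere_triangulation_nonempty [OF KS] max by blast
  then obtain x where x: "x \<in> rel_interior \<sigma>"
    using rel_interior_eq_empty simplicial_complex_polytope(1) [OF K \<open>\<sigma> \<in> K\<close>] by blast
  then have "x \<in> \<Union>K"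
    using rel_interior_subset \<open>\<sigma> \<in> K\<close> by blast
  then have hx: "h x \<in> sphere 0 1"
    using homeomorphism_image1 [OF g] by blast
  \<comment> \<open>Any point of the sphere other than \<open>h x\<close> could serve as the
    puncture; the antipode is a definite choice.\<close>
  define b where "b = - h x"
  have b: "norm b = 1" "b \<noteq> h x"
    using hx sphere_antipode_neq [of "h x"] by (simp_all add: b_def)
  define y where "y = g b"
  have y: "y \<in> \<Union>K" "h y = b"
    using homeomorphism_image2 [OF g] homeomorphism_apply2 [OF g, of b] b by (auto simp: y_def)
  \<comment> \<open>The radius is chosen so that \<open>S\<close> just misses the preimage
    \<open>y\<close> of the puncture; a ball keeps \<open>S\<close> convex, as the convex form of
    invariance of dimension requires.\<close>
  define S where "S = rel_interior \<sigma> \<inter> ball x (dist x y)"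
  have "x \<in> S" "y \<notin> S" "convex S"
    using x b y simplicial_complex_polytope(1) [OF K \<open>\<sigma> \<in> K\<close>]
    by (auto simp: S_def convex_Int convex_rel_interior)
  have SK: "S \<subseteq> \<Union>K"
    using rel_interior_subset \<open>\<sigma> \<in> K\<close> by (auto simp: S_def)
  have opeS: "openin (top_of_set (\<Union>K)) S"
    unfolding S_def using openin_rel_interior_maximal_simplex [OF K \<open>\<sigma> \<in> K\<close> max]
    by (simp add: openin_Int_open)
  have affS: "aff_dim S = aff_dim \<sigma>"
  proof -
    have "openin (top_of_set (affine hull \<sigma>)) S"
      unfolding S_def by (simp add: openin_Int_open openin_rel_interior)
    then show ?thesis
      using aff_dim_openin [of "affine hull \<sigma>" S] \<open>x \<in> S\<close> by (metis aff_dim_affine_hull affine_affine_hull empty_iff)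
  qed
  obtain \<phi> \<psi> where \<phi>: "homeomorphism (sphere 0 1 - {b}) (UNIV::complex set) \<phi> \<psi>"
    using punctured_sphere_homeomorphism_plane [OF b(1)] .
  have hS: "h ` S \<subseteq> sphere 0 1 - {b}"
  proof -
    have "h z \<noteq> b" if "z \<in> S" for z
      using homeomorphism_apply1 [OF g] y SK that \<open>y \<notin> S\<close> by (metis subsetD)
    then show ?thesis
      using homeomorphism_image1 [OF g] SK by blast
  qed
  let ?U = "\<phi> ` h ` S"
  have homS: "homeomorphism S (h ` S) h g" "homeomorphism (h ` S) ?U \<phi> \<psi>"
    using homeomorphism_of_subsets [OF g SK] homeomorphism_of_subsets [OF \<phi> hS]
      homeomorphism_image1 [OF g] SK hS by auto
  then have homU: "homeomorphism S ?U (\<phi> \<circ> h) (g \<circ> \<psi>)"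
    by (rule homeomorphism_compose)
  have "aff_dim S \<le> aff_dim (UNIV::complex set)"
  proof (rule invariance_of_dimension_convex_domain [OF \<open>convex S\<close>])
    show "continuous_on S (\<phi> \<circ> h)"
      using homU homeomorphism_cont1 by blast
    show "inj_on (\<phi> \<circ> h) S"
      by (rule inj_on_inverseI, rule homeomorphism_apply1 [OF homU])
  qed auto
  moreover have "2 \<le> aff_dim S"
  proof -
    have "openin (top_of_set (sphere 0 1)) (h ` S)"
      using homeomorphism_imp_open_map [OF g opeS] .
    then have "openin (top_of_set (sphere 0 1 - {b})) (h ` S)"
      using hS openin_subset_trans by blast
    then have "openin (top_of_set UNIV) ?U"
      using homeomorphism_imp_open_map [OF \<phi>] by blast
    then have "open ?U"
      by simp
    then obtain e where e: "e > 0" "ball (\<phi> (h x)) e \<subseteq> ?U"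
      using \<open>x \<in> S\<close> open_contains_ball by blast
    let ?B = "ball (\<phi> (h x)) e"
    have "aff_dim ?B \<le> aff_dim S"
    proof (rule invariance_of_dimension_convex_domain [OF convex_ball])
      show "continuous_on ?B (g \<circ> \<psi>)"
        using homU homeomorphism_cont2 e continuous_on_subset by blast
      show "inj_on (g \<circ> \<psi>) ?B"
        by (rule inj_on_inverseI, rule homeomorphism_apply2 [OF homU], rule subsetD [OF e(2)])
      show "(g \<circ> \<psi>) \<in> ?B \<rightarrow> affine hull S"
      proof
        fix z assume "z \<in> ?B"
        then have "(g \<circ> \<psi>) z \<in> (g \<circ> \<psi>) ` ?U"
          using e(2) by (intro imageI) (rule subsetD)
        then show "(g \<circ> \<psi>) z \<in> affine hull S"
          unfolding homeomorphism_image2 [OF homU] by (rule hull_inc)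
      qed
    qed
    then show ?thesis
      using e by (simp add: aff_dim_open)
  qed
  ultimately show ?thesis
    using affS by simp
qed

text \<open>By finiteness every simplex lies in a maximal one, which is a triangle. Conversely, a
  triangle properly contained in a simplex would be a proper face of it and force a dimension above
  2.\<close>

lemma sphere_triangulation_aff_dim:
  assumes KS: "sphere_triangulation K h" and "\<sigma> \<in> K"
  shows "\<exists>\<tau>\<in>K. \<sigma> \<subseteq> \<tau> \<and> aff_dim \<tau> = 2" and "aff_dim \<sigma> \<le> 2"
    and "aff_dim \<sigma> = 2 \<Longrightarrow> \<tau> \<in> K \<Longrightarrow> \<sigma> \<subseteq> \<tau> \<Longrightarrow> \<tau> = \<sigma>"
proof -
  have K: "simplicial_complex K"
    using KS by (simp add: sphere_triangulation_def)
  then have "finite K"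
    by (simp add: simplicial_complex_def)
  have ex: "\<exists>\<tau>\<in>K. \<sigma> \<subseteq> \<tau> \<and> aff_dim \<tau> = 2" if "\<sigma> \<in> K" for \<sigma>
    using finite_has_maximal2 [OF \<open>finite K\<close> that] aff_dim_maximal_simplex [OF KS] by metis
  have le: "aff_dim \<sigma> \<le> 2" if "\<sigma> \<in> K" for \<sigma>
    using ex [OF that] aff_dim_subset by metis
  show "\<exists>\<tau>\<in>K. \<sigma> \<subseteq> \<tau> \<and> aff_dim \<tau> = 2" "aff_dim \<sigma> \<le> 2"
    using ex le \<open>\<sigma> \<in> K\<close> by blast+
  assume \<sigma>: "aff_dim \<sigma> = 2" and \<tau>: "\<tau> \<in> K" "\<sigma> \<subseteq> \<tau>"
  have "\<sigma> face_of \<tau>"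
    using K \<tau> \<open>\<sigma> \<in> K\<close> unfolding simplicial_complex_def by (metis inf.absorb_iff2)
  then show "\<tau> = \<sigma>"
    using face_of_aff_dim_lt [of \<tau> \<sigma>] simplicial_complex_polytope(1) [OF K \<tau>(1)] \<sigma> le [OF \<tau>(1)]
    by fastforce
qed

section \<open>The 1-skeleton\<close>

definition skeleton1 :: "'a::euclidean_space set set \<Rightarrow> 'a set" where
  "skeleton1 K = \<Union>{\<sigma> \<in> K. aff_dim \<sigma> \<le> 1}"

text \<open>A simplex that meets the open triangle contains it, so it has dimension at least 2. The
  boundary points, in turn, lie on proper faces, of dimension at most 1.\<close>

lemma skeleton1_Int_triangle:
  assumes KS: "sphere_triangulation K h" and "\<sigma> \<in> K" "aff_dim \<sigma> = 2"
  shows "skeleton1 K \<inter> \<sigma> = rel_frontier \<sigma>"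
proof -
  have K: "simplicial_complex K"
    using KS by (simp add: sphere_triangulation_def)
  note poly = simplicial_complex_polytope [OF K \<open>\<sigma> \<in> K\<close>]
  have fr: "rel_frontier \<sigma> = \<sigma> - rel_interior \<sigma>"
    using poly by (simp add: rel_frontier_def)
  have "skeleton1 K \<inter> rel_interior \<sigma> = {}"
  proof -
    have "\<tau> \<inter> rel_interior \<sigma> = {}" if "\<tau> \<in> K" "aff_dim \<tau> \<le> 1" for \<tau>
      using simplicial_complex_face_subset(1) [OF K \<open>\<sigma> \<in> K\<close> \<open>\<tau> \<in> K\<close>] aff_dim_subset [of \<sigma> \<tau>] assms that
      by fastforce
    then show ?thesis
      unfolding skeleton1_def by blast
  qed
  moreover have "x \<in> skeleton1 K" if x: "x \<in> \<sigma>" "x \<notin> rel_interior \<sigma>" for x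
  proof -
    obtain \<tau> where \<tau>: "\<tau> \<in> K" "\<tau> face_of \<sigma>" "\<tau> \<noteq> \<sigma>" "x \<in> \<tau>"
      using simplicial_complex_rel_interior_or_proper_face [OF K \<open>\<sigma> \<in> K\<close> x] .
    then have "aff_dim \<tau> \<le> 1"
      using face_of_aff_dim_lt [of \<sigma> \<tau>] poly assms by simp
    then show ?thesis
      using \<tau> unfolding skeleton1_def by blast
  qed
  ultimately show ?thesis
    using fr by blast
qed

lemma closed_skeleton1:
  assumes "simplicial_complex K"
  shows "closed (skeleton1 K)"
  unfolding skeleton1_def using assms simplicial_complex_polytope(3) [OF assms]
  by (intro closed_Union) (auto simp: simplicial_complex_def)

lemma triangle_rel_interior_disjoint:
  assumes KS: "sphere_triangulation K h" and "\<sigma> \<in> K" "aff_dim \<sigma> = 2" "\<tau> \<in> K" "\<tau> \<noteq> \<sigma>"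
  shows "\<tau> \<inter> rel_interior \<sigma> = {}"
proof (rule ccontr)
  assume "\<tau> \<inter> rel_interior \<sigma> \<noteq> {}"
  then have "\<sigma> \<subseteq> \<tau>"
    using simplicial_complex_face_subset(1) KS assms by (metis sphere_triangulation_def)
  then show False
    using sphere_triangulation_aff_dim(3) [OF KS] assms by blast
qed

text \<open>A separation of the 1-skeleton would extend over every triangle, whose boundary is connected,
  to a separation of the sphere.\<close>

lemma connected_skeleton1:
  assumes KS: "sphere_triangulation K h"
  shows "connected (skeleton1 K)"
proof (rule ccontr)
  assume "\<not> connected (skeleton1 K)"
  obtain g where K: "simplicial_complex K" and g: "homeomorphism (\<Union>K) (sphere 0 1) h g"
    using KS unfolding sphere_triangulation_def by blast
  have "finite K"
    using K by (simp add: simplicial_complex_def)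
  have "connected (sphere (0::real^3) 1)"
    by (rule connected_sphere) simp
  then have conK: "connected (\<Union>K)"
    using g homeomorphism_cont2 homeomorphism_image2 connected_continuous_image by metis
  obtain A B where AB: "closed A" "closed B" "A \<noteq> {}" "B \<noteq> {}" "A \<union> B = skeleton1 K" "A \<inter> B = {}"
    using \<open>\<not> connected (skeleton1 K)\<close> closed_skeleton1 [OF K]
    unfolding connected_closed_set [OF closed_skeleton1 [OF K]] by blast
  define T where "T = {\<sigma> \<in> K. aff_dim \<sigma> = 2}"
  \<comment> \<open>Each triangle is assigned to the side of the separation that holds its
    boundary.\<close>
  define ext where "ext C = C \<union> \<Union>{\<sigma> \<in> T. rel_frontier \<sigma> \<subseteq> C}" for C
  have clo: "closed (ext C)" if "closed C" for C
    unfolding ext_def using that \<open>finite K\<close> simplicial_complex_polytope(3) [OF K]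
    by (intro closed_Un closed_Union) (auto simp: T_def)
  have Tfr: "skeleton1 K \<inter> \<sigma> = rel_frontier \<sigma>" if "\<sigma> \<in> T" for \<sigma>
    using skeleton1_Int_triangle [OF KS] that by (simp add: T_def)
  \<comment> \<open>A triangle with empty boundary would be assigned to both sides. It would be
    affine as well as bounded, hence at most a point.\<close>
  have Tne: "rel_frontier \<sigma> \<noteq> {}" if "\<sigma> \<in> T" for \<sigma>
  proof
    assume "rel_frontier \<sigma> = {}"
    then have "\<sigma> = {} \<or> (\<exists>a. \<sigma> = {a})"
      using that simplicial_complex_polytope(2) [OF K, of \<sigma>] compact_imp_bounded [of \<sigma>]
      by (simp add: T_def rel_frontier_eq_empty affine_bounded_eq_trivial)
    then show False
      using that by (auto simp: T_def)
  qed
  have side: "rel_frontier \<sigma> \<subseteq> A \<or> rel_frontier \<sigma> \<subseteq> B" if "\<sigma> \<in> T" for \<sigma>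
  proof -
    have "connected (rel_frontier \<sigma>)"
      using that simplicial_complex_polytope [OF K, of \<sigma>]
      by (intro connected_sphere_gen) (auto simp: T_def compact_imp_bounded)
    then show ?thesis
      using connected_closedD [of "rel_frontier \<sigma>" A B] AB Tfr [OF that] by blast
  qed
  have TT: "\<sigma> \<inter> \<tau> \<subseteq> rel_frontier \<sigma>" if "\<sigma> \<in> T" "\<tau> \<in> T" "\<sigma> \<noteq> \<tau>" for \<sigma> \<tau>
    using triangle_rel_interior_disjoint [OF KS, of \<sigma> \<tau>] that
      simplicial_complex_polytope(3) [OF K, of \<sigma>] by (auto simp: T_def rel_frontier_def)
  have disj: "ext A \<inter> ext B = {}"
  proof -
    have "\<sigma> \<inter> \<tau> = {}" if "\<sigma> \<in> T" "\<tau> \<in> T" "rel_frontier \<sigma> \<subseteq> A" "rel_frontier \<tau> \<subseteq> B" for \<sigma> \<tau>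
      using TT [OF that(1,2)] TT [OF that(2,1)] that Tne [OF that(1)] \<open>A \<inter> B = {}\<close> by blast
    moreover have "A \<inter> \<tau> = {}" if "\<tau> \<in> T" "rel_frontier \<tau> \<subseteq> B" for \<tau>
      using Tfr [OF that(1)] that AB by blast
    moreover have "\<tau> \<inter> B = {}" if "\<tau> \<in> T" "rel_frontier \<tau> \<subseteq> A" for \<tau>
      using Tfr [OF that(1)] that AB by blast
    ultimately show ?thesis
      using \<open>A \<inter> B = {}\<close> unfolding ext_def by blast
  qed
  have un: "\<Union>K \<subseteq> ext A \<union> ext B"
  proof
    fix x assume "x \<in> \<Union>K"
    then obtain \<sigma> where \<sigma>: "\<sigma> \<in> T" "x \<in> \<sigma>"
      using sphere_triangulation_aff_dim(1) [OF KS] unfolding T_def by blast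
    then show "x \<in> ext A \<union> ext B"
      using side unfolding ext_def by blast
  qed
  have "A \<subseteq> \<Union>K" "B \<subseteq> \<Union>K"
    using AB(5) unfolding skeleton1_def by blast+
  then have "ext A \<inter> \<Union>K \<noteq> {}" "ext B \<inter> \<Union>K \<noteq> {}"
    using AB(3,4) unfolding ext_def by blast+
  then show False
    using connected_closedD [OF conK _ un clo [OF AB(1)] clo [OF AB(2)]] disj by blast
qed

lemma skeleton1_eq:
  assumes K: "simplicial_complex K"
  shows "skeleton1 K = {v. {v} \<in> K} \<union> \<Union>{\<sigma> \<in> K. aff_dim \<sigma> = 1}"
proof -
  have "(\<exists>v. \<sigma> = {v}) \<or> aff_dim \<sigma> = 1" if "\<sigma> \<in> K" "aff_dim \<sigma> \<le> 1" "\<sigma> \<noteq> {}" for \<sigma>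
  proof -
    have "aff_dim \<sigma> \<noteq> -1" "- 1 \<le> aff_dim \<sigma>"
      using that aff_dim_geq by (auto simp: aff_dim_empty)
    then have "aff_dim \<sigma> = 0 \<or> aff_dim \<sigma> = 1"
      using that by linarith
    then show ?thesis
      using aff_dim_eq_0 by blast
  qed
  then have "\<sigma> \<subseteq> {v. {v} \<in> K} \<union> \<Union>{\<sigma> \<in> K. aff_dim \<sigma> = 1}" if "\<sigma> \<in> K" "aff_dim \<sigma> \<le> 1" for \<sigma>
    using that by blast
  moreover have "v \<in> \<Union>{\<sigma> \<in> K. aff_dim \<sigma> \<le> 1}" if "{v} \<in> K" for v
    using that aff_dim_sing [of v] by (intro UnionI [of "{v}"]) auto
  ultimately show ?thesis
    unfolding skeleton1_def by fastforce
qed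

text \<open>No vertex of the complex lies in the interior of an edge: a vertex on the edge is a face
  of it, hence an extreme point of the segment.\<close>

lemma edge_segment:
  assumes K: "simplicial_complex K" and "\<sigma> \<in> K" "aff_dim \<sigma> = 1"
  obtains a b where "a \<noteq> b" "\<sigma> = closed_segment a b" "\<sigma> \<inter> {v. {v} \<in> K} = {a, b}"
proof -
  have "1 simplex \<sigma>"
    using assms simplicial_complex_simplex_iff by blast
  then obtain C where C: "card C = 2" "\<sigma> = convex hull C"
    unfolding simplex_def by auto
  then obtain a b where ab: "a \<noteq> b" "C = {a, b}"
    by (meson card_2_iff)
  then have seg: "\<sigma> = closed_segment a b"
    using C by (simp add: segment_convex_hull)
  have "{v} \<in> K \<longleftrightarrow> v \<in> {a, b}" if "v \<in> \<sigma>" for v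
  proof
    assume "{v} \<in> K"
    then have "\<sigma> \<inter> {v} face_of \<sigma>"
      using K \<open>\<sigma> \<in> K\<close> unfolding simplicial_complex_def by blast
    then have "v extreme_point_of \<sigma>"
      using that by (simp add: face_of_singleton)
    then show "v \<in> {a, b}"
      using seg by (simp add: extreme_point_of_segment)
  next
    assume "v \<in> {a, b}"
    then have "{v} face_of \<sigma>"
      using seg by (auto simp: face_of_singleton extreme_point_of_segment)
    then show "{v} \<in> K"
      using K \<open>\<sigma> \<in> K\<close> unfolding simplicial_complex_def by blast
  qed
  then have "\<sigma> \<inter> {v. {v} \<in> K} = {a, b}"
    using seg by auto
  then show thesis
    using that ab seg by blast
qed

section \<open>Euler characteristic of the sphere\<close>

theorem sphere_triangulation_Euler:
  fixes K :: "'a::euclidean_space set set" and h :: "'a \<Rightarrow> real^3"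
  assumes KS: "sphere_triangulation K h"
  shows "card {\<sigma> \<in> K. aff_dim \<sigma> = 0} + card {\<sigma> \<in> K. aff_dim \<sigma> = 2}
    = card {\<sigma> \<in> K. aff_dim \<sigma> = 1} + 2"
proof -
  obtain g where K: "simplicial_complex K" and g: "homeomorphism (\<Union>K) (sphere 0 1) h g"
    using KS unfolding sphere_triangulation_def by blast
  have "finite K"
    using K by (simp add: simplicial_complex_def)
  note poly = simplicial_complex_polytope [OF K]
  define V where "V = {v. {v} \<in> K}"
  define E where "E = {\<sigma> \<in> K. aff_dim \<sigma> = 1}"
  define T where "T = {\<sigma> \<in> K. aff_dim \<sigma> = 2}"
  have TK: "\<sigma> \<in> K" "aff_dim \<sigma> = 2" if "\<sigma> \<in> T" for \<sigma>
    using that by (auto simp: T_def)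
  have sk: "skeleton1 K = V \<union> \<Union>E"
    using skeleton1_eq [OF K] by (simp add: V_def E_def)
  have cardV: "card {\<sigma> \<in> K. aff_dim \<sigma> = 0} = card V"
  proof -
    have "{\<sigma> \<in> K. aff_dim \<sigma> = 0} = (\<lambda>v. {v}) ` V"
      by (auto simp: V_def aff_dim_eq_0)
    then show ?thesis
      by (simp add: card_image)
  qed
  have "finite V"
    using \<open>finite K\<close> finite_vimageI [of K "\<lambda>v. {v}"] by (simp add: V_def vimage_def)
  obtain t0 where t0: "t0 \<in> T"
    using sphere_triangulation_nonempty [OF KS] sphere_triangulation_aff_dim(1) [OF KS]
    unfolding T_def by blast
  then have "t0 \<noteq> {}"
    using TK by fastforce
  have "V \<noteq> {}"
  proof -
    obtain v where "v extreme_point_of t0"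
      using extreme_point_exists_convex [of t0] poly [OF TK(1) [OF t0]] \<open>t0 \<noteq> {}\<close> by blast
    then have "{v} face_of t0"
      by (simp add: face_of_singleton)
    then show ?thesis
      using K TK(1) [OF t0] unfolding V_def simplicial_complex_def by blast
  qed
  \<comment> \<open>The point sent to infinity is interior to a triangle, so all vertices and edges
    survive in the plane.\<close>
  obtain p where p: "p \<in> rel_interior t0"
    using rel_interior_eq_empty poly(1) [OF TK(1) [OF t0]] \<open>t0 \<noteq> {}\<close> by blast
  have pK: "p \<in> \<Union>K"
    using p rel_interior_subset TK(1) [OF t0] by blast
  have skT: "skeleton1 K \<inter> rel_interior \<sigma> = {}" if "\<sigma> \<in> T" for \<sigma>
    using skeleton1_Int_triangle [OF KS TK [OF that]] rel_interior_subset [of \<sigma>]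
    unfolding rel_frontier_def by blast
  have "h p \<in> sphere 0 1"
    using homeomorphism_image1 [OF g] pK by blast
  then have "norm (h p) = 1"
    by simp
  then obtain \<phi> \<psi> where \<phi>: "homeomorphism (sphere 0 1 - {h p}) (UNIV::complex set) \<phi> \<psi>"
    using punctured_sphere_homeomorphism_plane by blast
  define X where "X = \<Union>K - {p}"
  have "inj_on h (\<Union>K)"
    by (rule inj_on_inverseI, rule homeomorphism_apply1 [OF g])
  then have "h ` X = sphere 0 1 - {h p}"
    using inj_on_image_set_diff [of h "\<Union>K" "\<Union>K" "{p}"] homeomorphism_image1 [OF g] pK
    unfolding X_def by simp
  then have "homeomorphism X (sphere 0 1 - {h p}) h g"
    using homeomorphism_of_subsets [OF g, of X] unfolding X_def by blast
  then obtain f f' where f: "homeomorphism X (UNIV::complex set) f f'"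
    using homeomorphism_compose \<phi> by blast
  have inj: "inj_on f X"
    by (rule inj_on_inverseI, rule homeomorphism_apply1 [OF f])
  have skX: "skeleton1 K \<subseteq> X"
    using skT [OF t0] p unfolding X_def skeleton1_def by blast
  have EX: "\<sigma> \<subseteq> X" if "\<sigma> \<in> E" for \<sigma>
    using skX that unfolding sk by blast
  have VX: "V \<subseteq> X"
    using skX unfolding sk by blast
  let ?E = "(`) f ` E"
  have graph: "plane_graph (f ` V) ?E"
    unfolding plane_graph_def
  proof (intro conjI ballI)
    show "finite (f ` V)" "finite ?E"
      using \<open>finite V\<close> \<open>finite K\<close> by (auto simp: E_def)
    show "\<exists>c. arc c \<and> path_image c = e \<and> e \<inter> f ` V = {pathstart c, pathfinish c}" if e: "e \<in> ?E" for e
    proof -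
      obtain \<sigma> where \<sigma>: "\<sigma> \<in> E" "e = f ` \<sigma>"
        using e by blast
      obtain a b where ab: "a \<noteq> b" "\<sigma> = closed_segment a b" "\<sigma> \<inter> V = {a, b}"
        using edge_segment [OF K] \<sigma>(1) unfolding E_def V_def by blast
      have img: "path_image (linepath a b) \<subseteq> X"
        using EX [OF \<sigma>(1)] ab by simp
      have "arc (f \<circ> linepath a b)"
        unfolding arc_def
      proof
        show "path (f \<circ> linepath a b)"
          using img homeomorphism_cont1 [OF f] continuous_on_subset
          by (intro path_continuous_image) auto
        show "inj_on (f \<circ> linepath a b) {0..1}"
          using img inj arc_imp_inj_on [OF arc_linepath [OF ab(1)]]
          by (metis comp_inj_on inj_on_subset path_image_def)
      qed
      moreover have "path_image (f \<circ> linepath a b) = e"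
        using ab \<sigma> by (simp add: path_image_compose)
      moreover have "e \<inter> f ` V = f ` {a, b}"
        using inj_on_image_Int [OF inj EX [OF \<sigma>(1)] VX] ab \<sigma> by simp
      ultimately show ?thesis
        by (intro exI [of _ "f \<circ> linepath a b"]) (simp add: pathstart_compose pathfinish_compose)
    qed
    show "pairwise (\<lambda>e e'. e \<inter> e' \<subseteq> f ` V) ?E"
    proof (rule pairwiseI, elim imageE)
      fix e e' \<sigma> \<tau> assume \<sigma>: "e = f ` \<sigma>" "\<sigma> \<in> E" and \<tau>: "e' = f ` \<tau>" "\<tau> \<in> E" and "e \<noteq> e'"
      then have "\<sigma> \<noteq> \<tau>" by blast
      have \<sigma>K: "\<sigma> \<in> K" "\<tau> \<in> K" and dims: "aff_dim \<sigma> = 1" "aff_dim \<tau> = 1"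
        using \<sigma> \<tau> by (auto simp: E_def)
      have face: "\<sigma> \<inter> \<tau> face_of \<sigma>" "\<tau> \<inter> \<sigma> face_of \<tau>"
        using K \<sigma>K unfolding simplicial_complex_def by blast+
      \<comment> \<open>Otherwise \<open>\<sigma>\<close> would be a proper face of
        \<open>\<tau>\<close> of the same dimension. The intersection is thus a proper face of an
        edge: empty or a vertex.\<close>
      have "\<sigma> \<inter> \<tau> \<noteq> \<sigma>"
        using face_of_aff_dim_lt [OF poly(1) [OF \<sigma>K(2)] face(2)] \<open>\<sigma> \<noteq> \<tau>\<close> dims
        by (metis Int_commute less_irrefl)
      then have "aff_dim (\<sigma> \<inter> \<tau>) < 1"
        using face_of_aff_dim_lt [OF poly(1) [OF \<sigma>K(1)] face(1)] dims by simp
      then have "aff_dim (\<sigma> \<inter> \<tau>) = -1 \<or> aff_dim (\<sigma> \<inter> \<tau>) = 0"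
        using aff_dim_geq [of "\<sigma> \<inter> \<tau>"] by linarith
      then have "\<sigma> \<inter> \<tau> = {} \<or> (\<exists>v. \<sigma> \<inter> \<tau> = {v})"
        by (metis aff_dim_empty aff_dim_eq_0)
      moreover have "\<sigma> \<inter> \<tau> \<in> K"
        using K \<sigma>K face unfolding simplicial_complex_def by blast
      ultimately have "\<sigma> \<inter> \<tau> \<subseteq> V"
        unfolding V_def by (metis empty_subsetI insert_subset mem_Collect_eq)
      then show "e \<inter> e' \<subseteq> f ` V"
        using inj_on_image_Int [OF inj EX [OF \<sigma>(2)] EX [OF \<tau>(2)]] \<sigma> \<tau> by blast
    qed
  qed
  have un: "f ` V \<union> \<Union>?E = f ` skeleton1 K"
    unfolding sk by blast
  have con: "connected (f ` skeleton1 K)"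
    using connected_skeleton1 [OF KS] skX homeomorphism_cont1 [OF f]
    by (meson connected_continuous_image continuous_on_subset)
  have Euler: "card (f ` V) + card (components (- (f ` skeleton1 K))) = card ?E + 2"
    using plane_graph_Euler [OF graph] con \<open>V \<noteq> {}\<close> unfolding un by simp
  have "card (f ` V) = card V"
    using inj VX by (meson card_image inj_on_subset)
  moreover have "card ?E = card E"
    using inj EX by (intro card_image) (meson inj_on_image_Pow PowI inj_on_subset subsetI)
  moreover have "card (components (- (f ` skeleton1 K))) = card T"
  proof -
    \<comment> \<open>Only the interior of \<open>t0\<close> contains \<open>p\<close>; removing it
      from every triangle keeps the formula uniform.\<close>
    define F where "F \<sigma> = f ` (rel_interior \<sigma> - {p})" for \<sigma>
    have TX: "rel_interior \<sigma> - {p} \<subseteq> X" if "\<sigma> \<in> T" for \<sigma>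
      using rel_interior_subset TK(1) [OF that] unfolding X_def by blast
    have face: "open (F \<sigma>) \<and> connected (F \<sigma>) \<and> F \<sigma> \<noteq> {}" if \<sigma>: "\<sigma> \<in> T" for \<sigma>
    proof (intro conjI)
      have "openin (top_of_set (\<Union>K)) (rel_interior \<sigma>)"
        using openin_rel_interior_maximal_simplex [OF K TK(1) [OF \<sigma>]]
          sphere_triangulation_aff_dim(3) [OF KS TK [OF \<sigma>]] by blast
      then have "openin (top_of_set X) (rel_interior \<sigma> - {p})"
        unfolding X_def by (auto simp: openin_open)
      then have "openin (top_of_set UNIV) (F \<sigma>)"
        unfolding F_def using homeomorphism_imp_open_map [OF f] by blast
      then show "open (F \<sigma>)"
        by simp
      have conv: "convex \<sigma>"
        using poly TK(1) \<sigma> by blast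
      have aff: "aff_dim (rel_interior \<sigma>) = 2"
        using conv TK(2) [OF \<sigma>] by (metis aff_dim_affine_hull rel_interior_same_affine_hull)
      \<comment> \<open>Dimension 2 matters here: an open segment would fall apart at the
        puncture.\<close>
      have "connected (rel_interior \<sigma> - {p})"
        using conv aff by (intro connected_punctured_convex) (auto simp: convex_rel_interior)
      then show "connected (F \<sigma>)"
        unfolding F_def using TX [OF \<sigma>] homeomorphism_cont1 [OF f]
        by (meson connected_continuous_image continuous_on_subset)
      have "\<not> rel_interior \<sigma> \<subseteq> {p}"
        using aff aff_dim_subset [of "rel_interior \<sigma>" "{p}"] by auto
      then show "F \<sigma> \<noteq> {}"
        unfolding F_def by blast
    qed
    have disj: "F \<sigma> \<inter> F \<tau> = {}" if "\<sigma> \<in> T" "\<tau> \<in> T" "\<sigma> \<noteq> \<tau>" for \<sigma> \<tau>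
    proof -
      have "\<tau> \<inter> rel_interior \<sigma> = {}"
        using triangle_rel_interior_disjoint [OF KS TK [OF that(1)] TK(1) [OF that(2)]] that by blast
      then have "(rel_interior \<sigma> - {p}) \<inter> (rel_interior \<tau> - {p}) = {}"
        using rel_interior_subset [of \<tau>] by blast
      then show ?thesis
        unfolding F_def using inj_on_image_Int [OF inj TX [OF that(1)] TX [OF that(2)]] by simp
    qed
    have "\<Union>(F ` T) = - (f ` skeleton1 K)"
    proof -
      have "X - skeleton1 K = \<Union>((\<lambda>\<sigma>. rel_interior \<sigma> - {p}) ` T)" (is "?L = ?R")
      proof
        show "?L \<subseteq> ?R"
        proof
          fix x assume x: "x \<in> ?L"
          then obtain \<sigma> where \<sigma>: "\<sigma> \<in> T" "x \<in> \<sigma>"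
            using sphere_triangulation_aff_dim(1) [OF KS] unfolding T_def X_def by blast
          have "x \<notin> rel_frontier \<sigma>"
            using skeleton1_Int_triangle [OF KS TK [OF \<sigma>(1)]] x by blast
          then have "x \<in> rel_interior \<sigma>"
            using \<sigma> closure_subset [of \<sigma>] unfolding rel_frontier_def by blast
          then show "x \<in> ?R"
            using \<sigma> x unfolding X_def by blast
        qed
        show "?R \<subseteq> ?L"
          using TX skT by blast
      qed
      moreover have "\<Union>(F ` T) = f ` \<Union>((\<lambda>\<sigma>. rel_interior \<sigma> - {p}) ` T)"
        unfolding F_def by blast
      moreover have "f ` (X - skeleton1 K) = - (f ` skeleton1 K)"
        using inj_on_image_set_diff [OF inj _ skX, of X] homeomorphism_image1 [OF f] by auto
      ultimately show ?thesis
        by simp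
    qed
    moreover have "components (\<Union>(F ` T)) = F ` T"
      using face disj by (intro components_Union_open) (auto simp: pairwise_def disjnt_def)
    moreover have "inj_on F T"
      using face disj unfolding inj_on_def by blast
    ultimately show ?thesis
      by (metis card_image)
  qed
  ultimately show ?thesis
    using Euler cardV by (simp add: E_def T_def)
qed

subsection \<open>The antipodal quotient\<close>

text \<open>The pulled-back antipodal map \<open>\<lambda>x. g (- h x)\<close> is its own inverse,
  which explains why it occurs on both sides. For \<open>\<tau> \<noteq> \<sigma>\<close> it serves
  to compare dimensions; for \<open>\<tau> = \<sigma>\<close> it is the self-map given to Brouwer's
  theorem.\<close>

lemma homeomorphism_antipodal_simplex:
  fixes K :: "'a::euclidean_space set set" and h :: "'a \<Rightarrow> real^3"
  assumes g: "homeomorphism (\<Union>K) (sphere 0 1) h g" and K: "\<sigma> \<in> K" "\<tau> \<in> K"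
    and eq: "h ` \<tau> = uminus ` h ` \<sigma>"
  shows "homeomorphism \<sigma> \<tau> (\<lambda>x. g (- h x)) (\<lambda>x. g (- h x))"
proof -
  have eq': "h ` \<sigma> = uminus ` h ` \<tau>"
    using eq by (simp add: image_image)
  have nh: "norm (h x) = 1" if "x \<in> \<rho>" "\<rho> \<in> K" for x \<rho>
  proof -
    have "h x \<in> sphere 0 1"
      using that homeomorphism_image1 [OF g] by blast
    then show ?thesis
      by simp
  qed
  have gh: "g (h x) = x" "norm (h x) = 1" if "x \<in> \<sigma> \<or> x \<in> \<tau>" for x
    using that K homeomorphism_apply1 [OF g, of x] nh by auto
  have hg: "h (g y) = y" if "norm y = 1" for y
    using that homeomorphism_apply2 [OF g] by auto
  have cont: "continuous_on \<rho> (\<lambda>x. g (- h x))" if "\<rho> \<in> K" for \<rho>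
  proof (rule continuous_on_compose2 [OF homeomorphism_cont2 [OF g]])
    show "continuous_on \<rho> (\<lambda>x. - h x)"
      using homeomorphism_cont1 [OF g] that
      by (intro continuous_on_minus) (auto intro: continuous_on_subset)
    show "(\<lambda>x. - h x) ` \<rho> \<subseteq> sphere 0 1"
      using nh that by auto
  qed
  have mapsto: "g (- h x) \<in> \<tau>'" if x: "x \<in> \<sigma>'" "h ` \<tau>' = uminus ` h ` \<sigma>'" "\<tau>' \<in> {\<sigma>, \<tau>}" for x \<sigma>' \<tau>'
  proof -
    have "- h x \<in> h ` \<tau>'"
      using x by simp
    then obtain y where "y \<in> \<tau>'" "h y = - h x"
      by (metis imageE)
    then show ?thesis
      using gh(1) [of y] x(3) by auto
  qed
  have inv: "g (- h (g (- h x))) = x" if "x \<in> \<sigma> \<or> x \<in> \<tau>" for x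
    using gh [OF that] hg [of "- h x"] by simp
  show ?thesis
  proof (rule homeomorphismI)
    show "continuous_on \<sigma> (\<lambda>x. g (- h x))" "continuous_on \<tau> (\<lambda>x. g (- h x))"
      using cont K by auto
    show "(\<lambda>x. g (- h x)) ` \<sigma> \<subseteq> \<tau>" "(\<lambda>x. g (- h x)) ` \<tau> \<subseteq> \<sigma>"
      using mapsto [OF _ eq] mapsto [OF _ eq'] by blast+
    show "g (- h (g (- h x))) = x" if "x \<in> \<sigma>" for x
      using inv that by blast
    show "g (- h (g (- h y))) = y" if "y \<in> \<tau>" for y
      using inv that by blast
  qed
qed

lemma card_involution_orbits:
  assumes "finite A" and f: "\<And>x. x \<in> A \<Longrightarrow> f x \<in> A" "\<And>x. x \<in> A \<Longrightarrow> f x \<noteq> x"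
    "\<And>x. x \<in> A \<Longrightarrow> f (f x) = x"
  shows "2 * card ((\<lambda>x. {x, f x}) ` A) = card A"
proof -
  let ?C = "(\<lambda>x. {x, f x}) ` A"
  have un: "\<Union>?C = A"
    using f(1) by blast
  have "2 * card ?C = card (\<Union>?C)"
  proof (rule card_partition)
    show "finite ?C" "finite (\<Union>?C)"
      using \<open>finite A\<close> by (simp_all only: un finite_imageI)
    show "card c = 2" if "c \<in> ?C" for c
      using that f(2) unfolding card_2_iff by blast
    show "c \<inter> d = {}" if "c \<in> ?C" "d \<in> ?C" "c \<noteq> d" for c d
    proof -
      obtain x y where xy: "x \<in> A" "y \<in> A" "c = {x, f x}" "d = {y, f y}"
        using \<open>c \<in> ?C\<close> \<open>d \<in> ?C\<close> by blast
      have "c = d" if "y = x \<or> y = f x"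
        using that xy f(3) [of x] by auto
      moreover have "y = x \<or> y = f x" if "c \<inter> d \<noteq> {}"
        using that xy f(3) [of x] f(3) [of y] by (metis Int_iff all_not_in_conv insertE singletonD)
      ultimately show ?thesis
        using \<open>c \<noteq> d\<close> by blast
    qed
  qed
  then show ?thesis
    unfolding un .
qed

text \<open>A simplex equal to its antipode would, by Brouwer's theorem, contain a fixed point of the
  antipodal map.\<close>

lemma double_card_projective_simplices:
  assumes KP: "projective_plane_triangulation K h" and "0 \<le> i"
  shows "2 * card (projective_simplices K h i) = card {\<sigma> \<in> K. aff_dim \<sigma> = i}"
proof -
  obtain g where K: "simplicial_complex K" and g: "homeomorphism (\<Union>K) (sphere 0 1) h g"
    and sym: "centrally_symmetric K h"
    using KP unfolding projective_plane_triangulation_def sphere_triangulation_def by blast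
  note poly = simplicial_complex_polytope [OF K]
  define \<S> where "\<S> = sphere_simplices K h i"
  have \<S>: "\<S> = (`) h ` {\<sigma> \<in> K. aff_dim \<sigma> = i}"
    using simplicial_complex_simplex_iff [OF K] unfolding \<S>_def sphere_simplices_def by blast
  have "inj_on h (\<Union>K)"
    by (rule inj_on_inverseI, rule homeomorphism_apply1 [OF g])
  then have card: "card \<S> = card {\<sigma> \<in> K. aff_dim \<sigma> = i}"
    unfolding \<S> by (intro card_image inj_on_subset [OF inj_on_image_Pow]) auto
  have "finite \<S>"
    using K unfolding \<S> simplicial_complex_def by simp
  have minus: "uminus ` S \<in> \<S>" "uminus ` S \<noteq> S" if S: "S \<in> \<S>" for S
  proof -
    obtain \<sigma> where \<sigma>: "\<sigma> \<in> K" "aff_dim \<sigma> = i" "S = h ` \<sigma>"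
      using S unfolding \<S> by blast
    then obtain \<tau> where \<tau>: "\<tau> \<in> K" "h ` \<tau> = uminus ` h ` \<sigma>"
      using sym unfolding centrally_symmetric_def by blast
    note hom = homeomorphism_antipodal_simplex [OF g \<sigma>(1) \<tau>]
    \<comment> \<open>Central symmetry does not mention dimensions; they agree because homeomorphic
      compact convex sets have equal affine dimension.\<close>
    then have "aff_dim \<tau> = aff_dim \<sigma>"
      using homeomorphic_convex_compact_sets_eq poly \<sigma> \<tau> unfolding homeomorphic_def by metis
    then have "h ` \<tau> \<in> \<S>"
      using \<sigma> \<tau>(1) unfolding \<S> by simp
    then show "uminus ` S \<in> \<S>"
      using \<sigma>(3) \<tau>(2) by simp
    show "uminus ` S \<noteq> S"
    proof
      assume "uminus ` S = S"
      then have "h ` \<sigma> = uminus ` h ` \<sigma>"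
        using \<sigma> by simp
      note hom = homeomorphism_antipodal_simplex [OF g \<sigma>(1) \<sigma>(1) this]
      \<comment> \<open>The empty simplex, of dimension -1, is its own antipode;
        \<open>0 \<le> i\<close> rules it out.\<close>
      have "\<sigma> \<noteq> {}"
        using \<sigma>(2) \<open>0 \<le> i\<close> by auto
      then obtain x where x: "x \<in> \<sigma>" "g (- h x) = x"
        using brouwer [OF poly(2,1) [OF \<sigma>(1)] _ homeomorphism_cont1 [OF hom]]
          homeomorphism_image1 [OF hom] by blast
      have hx: "h x \<in> sphere 0 1"
        using homeomorphism_image1 [OF g] x \<sigma>(1) by blast
      then have "- h x = h x"
        using homeomorphism_apply2 [OF g, of "- h x"] x by simp
      then show False
        using sphere_antipode_neq [OF hx] by simp
    qed
  qed
  \<comment> \<open>The relation lives on all subsets of space, so its classes are plain antipodal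
    pairs; by \<open>minus\<close> they stay inside \<open>\<S>\<close> and have two distinct
    members.\<close>
  have cls: "antipodal_rel `` {S} = {S, uminus ` S}" for S
    by (auto simp: antipodal_rel_def)
  have Q: "projective_simplices K h i = (\<lambda>S. {S, uminus ` S}) ` \<S>"
    unfolding projective_simplices_def quotient_def \<S>_def cls by blast
  have "2 * card ((\<lambda>S. {S, uminus ` S}) ` \<S>) = card \<S>"
    using \<open>finite \<S>\<close> minus by (intro card_involution_orbits) (simp_all add: image_image)
  then show ?thesis
    using Q card by simp
qed

theorem mainTheorem4:
  fixes K :: "'a::euclidean_space set set" and h :: "'a \<Rightarrow> real^3"
  assumes "projective_plane_triangulation K h"
  shows "int (card (projective_simplices K h 0)) - int (card (projective_simplices K h 1))
           + int (card (projective_simplices K h 2)) = 1"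
proof -
  have "sphere_triangulation K h"
    using assms by (simp add: projective_plane_triangulation_def)
  then show ?thesis
    using sphere_triangulation_Euler [of K h] double_card_projective_simplices [OF assms, of 0]
      double_card_projective_simplices [OF assms, of 1]
      double_card_projective_simplices [OF assms, of 2] by linarith
qed

end
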